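(* Let $R$ be a ring such that, for every positive integer $n$, every $n$-absorbing ideal of $R$ is strongly $n$-absorbing. Let $B$ be an amount $R$-algebra, with amount function $A: B\to \mathrm{Id}(R)$, $f\mapsto A_f$, and function $\epsilon:\mathrm{Id}(R)\to\mathrm{Id}(B)$, $I\mapsto I^{\epsilon}$. If $I$ is a radical ideal of $R$, then $\omega_B(I^{\epsilon})=\omega_R(I)$.
   Context: All rings are commutative with identity and all algebras are unitary (and commutative). $\mathrm{Id}(R)$ denotes the set of all ideals of a ring $R$; $J^0=R$ for an ideal $J$ of $R$. An ideal $I$ is radical if $I=\sqrt{I}$. Amount function: for an $R$-algebra $B$, a function $A: B\to\mathrm{Id}(R)$, $f\mapsto A_f$, is an amount function if for all $r\in R$ and $f,g\in B$: (1) $A_0=(0)$ and $A_1=R$; (2) $A_f=(0)$ implies $f=0$; (3) $A_{rf}=rA_f$; (4) $A_{fg}\subseteq A_fA_g$. Amount algebra: an $R$-algebra $B$ is an amount $R$-algebra if (1) there is an amount function $A:B\to\mathrm{Id}(R)$ such that for all $f,g\in B$ there are non-negative integers $m,n$ with $A_f^mA_g^nA_{fg}=A_f^{m+1}A_g^{n+1}$; and (2) there is a function $\epsilon:\mathrm{Id}(R)\to\mathrm{Id}(B)$, $I\mapsto I^{\epsilon}$, such that (a) $A_f\subseteq I$ if and only if $f\in I^{\epsilon}$, for all $f\in B$ and $I\in\mathrm{Id}(R)$, and (b) $I^{\epsilon}\cap R=I$ for all $I\in\mathrm{Id}(R)$ (where $I^\epsilon\cap R$ is the preimage of $I^\epsilon$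 under the structure map $R\to B$). Absorbing ideals: for a positive integer $n$, a proper ideal $I$ of $R$ is $n$-absorbing if whenever $r_1\cdots r_{n+1}\in I$ with $r_1,\ldots,r_{n+1}\in R$, there are $n$ of the $r_i$'s whose product is in $I$. A proper ideal $I$ of $R$ is strongly $n$-absorbing if whenever $I_1\cdots I_{n+1}\subseteq I$ for ideals $I_1,\ldots,I_{n+1}$ of $R$, there are $n$ of the $I_i$'s whose product is contained in $I$. If $I$ is $n$-absorbing for some positive integer $n$, then $\omega_R(I)=\min\{n : I \text{ is an } n\text{-absorbing ideal of } R\}$; otherwise $\omega_R(I)=\infty$. *)

theory Defs
  imports "HOL-Algebra.Module" "HOL-Algebra.Ideal_Product" "HOL-Library.Extended_Nat"
begin

text \<open>
  Products and powers of ideals are those of the multiplicative monoid of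
  \<^const>\<open>ideals_set\<close>, whose unit is the whole ring; hence the zeroth power of any
  ideal is the ring. The structure map of an \<open>R\<close>-algebra \<open>B\<close> is \<open>r \<mapsto> r \<odot>\<^bsub>B\<^esub> \<one>\<^bsub>B\<^esub>\<close>.
\<close>

definition ideal_sqrt :: "('a, 'm) ring_scheme \<Rightarrow> 'a set \<Rightarrow> 'a set" where
  "ideal_sqrt R I = {r \<in> carrier R. \<exists>k::nat. 0 < k \<and> r [^]\<^bsub>R\<^esub> k \<in> I}"

definition radical_ideal :: "'a set \<Rightarrow> ('a, 'm) ring_scheme \<Rightarrow> bool" where
  "radical_ideal I R \<longleftrightarrow> ideal I R \<and> I = ideal_sqrt R I"

text \<open>
  A family of \<open>n + 1\<close> factors is indexed by \<open>{..n}\<close>. Choosing \<open>n\<close> of the factors means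
  omitting the factor with one particular index, so repeated values are harmless.
\<close>

definition absorbing_ideal :: "nat \<Rightarrow> 'a set \<Rightarrow> ('a, 'm) ring_scheme \<Rightarrow> bool" where
  "absorbing_ideal n I R \<longleftrightarrow>
     0 < n \<and> ideal I R \<and> I \<noteq> carrier R \<and>
     (\<forall>r \<in> {..n} \<rightarrow> carrier R.
        (\<Otimes>\<^bsub>R\<^esub> i \<in> {..n}. r i) \<in> I \<longrightarrow>
        (\<exists>j \<in> {..n}. (\<Otimes>\<^bsub>R\<^esub> i \<in> {..n} - {j}. r i) \<in> I))"

definition strongly_absorbing_ideal :: "nat \<Rightarrow> 'a set \<Rightarrow> ('a, 'm) ring_scheme \<Rightarrow> bool" where
  "strongly_absorbing_ideal n I R \<longleftrightarrow>
     0 < n \<and> ideal I R \<and> I \<noteq> carrier R \<and>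
     (\<forall>J \<in> {..n} \<rightarrow> {K. ideal K R}.
        (\<Otimes>\<^bsub>ideals_set R\<^esub> i \<in> {..n}. J i) \<subseteq> I \<longrightarrow>
        (\<exists>j \<in> {..n}. (\<Otimes>\<^bsub>ideals_set R\<^esub> i \<in> {..n} - {j}. J i) \<subseteq> I))"

definition absorbing_number :: "('a, 'm) ring_scheme \<Rightarrow> 'a set \<Rightarrow> enat" where
  "absorbing_number R I =
     (if \<exists>n. absorbing_ideal n I R then enat (LEAST n. absorbing_ideal n I R) else \<infinity>)"

locale amount_function = algebra R B
  for R :: "('a, 'm) ring_scheme" (structure)
    and B :: "('a, 'b, 'c) module_scheme" (structure) +
  fixes A :: "'b \<Rightarrow> 'a set"
  assumes amount_ideal: "f \<in> carrier B \<Longrightarrow> ideal (A f) R"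
    and amount_zero: "A \<zero>\<^bsub>B\<^esub> = {\<zero>\<^bsub>R\<^esub>}"
    and amount_one: "A \<one>\<^bsub>B\<^esub> = carrier R"
    and amount_eq_zeroD: "\<lbrakk>f \<in> carrier B; A f = {\<zero>\<^bsub>R\<^esub>}\<rbrakk> \<Longrightarrow> f = \<zero>\<^bsub>B\<^esub>"
    and amount_smult:
      "\<lbrakk>r \<in> carrier R; f \<in> carrier B\<rbrakk> \<Longrightarrow> A (r \<odot>\<^bsub>B\<^esub> f) = r <#\<^bsub>R\<^esub> A f"
    and amount_mult:
      "\<lbrakk>f \<in> carrier B; g \<in> carrier B\<rbrakk> \<Longrightarrow> A (f \<otimes>\<^bsub>B\<^esub> g) \<subseteq> A f \<cdot>\<^bsub>R\<^esub> A g"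

locale amount_algebra = amount_function R B A
  for R :: "('a, 'm) ring_scheme" (structure)
    and B :: "('a, 'b, 'c) module_scheme" (structure)
    and A :: "'b \<Rightarrow> 'a set" +
  fixes \<epsilon> :: "'a set \<Rightarrow> 'b set"
  assumes amount_formula:
      "\<lbrakk>f \<in> carrier B; g \<in> carrier B\<rbrakk> \<Longrightarrow>
       \<exists>(m::nat) (n::nat).
         (A f [^]\<^bsub>ideals_set R\<^esub> m) \<cdot>\<^bsub>R\<^esub> (A g [^]\<^bsub>ideals_set R\<^esub> n) \<cdot>\<^bsub>R\<^esub> A (f \<otimes>\<^bsub>B\<^esub> g) =
         (A f [^]\<^bsub>ideals_set R\<^esub> (m + 1)) \<cdot>\<^bsub>R\<^esub> (A g [^]\<^bsub>ideals_set R\<^esub> (n + 1))"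
    and eps_ideal: "ideal I R \<Longrightarrow> ideal (\<epsilon> I) B"
    and amount_subset_iff:
      "\<lbrakk>ideal I R; f \<in> carrier B\<rbrakk> \<Longrightarrow> A f \<subseteq> I \<longleftrightarrow> f \<in> \<epsilon> I"
    and eps_contract: "ideal I R \<Longrightarrow> {r \<in> carrier R. r \<odot>\<^bsub>B\<^esub> \<one>\<^bsub>B\<^esub> \<in> \<epsilon> I} = I"

end

theory Submission
  imports Defs
begin

text \<open>
  For every \<open>n\<close>, the ideal \<open>I\<^sup>\<epsilon>\<close> is \<open>n\<close>-absorbing in \<open>B\<close> if and only if \<open>I\<close> is
  \<open>n\<close>-absorbing in \<open>R\<close>; equality of the absorbing numbers is then immediate, infinite values and
  \<open>I = R\<close> included.

  That \<open>n\<close>-absorption descends from \<open>I\<^sup>\<epsilon>\<close> to \<open>I\<close> is the general fact that a ring homomorphism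
  pulls it back, because \<open>I\<close> is the preimage of \<open>I\<^sup>\<epsilon>\<close> under the structure map.

  For the converse the question is translated from elements of \<open>B\<close> to ideals of \<open>R\<close>, membership of
  \<open>f\<close> in \<open>I\<^sup>\<epsilon>\<close> being \<open>A f \<subseteq> I\<close>. A radical ideal cannot see exponents of factors, so the formula
  \<open>A\<^sub>f\<^sup>m A\<^sub>g\<^sup>n A\<^sub>f\<^sub>g = A\<^sub>f\<^sup>m\<^sup>+\<^sup>1 A\<^sub>g\<^sup>n\<^sup>+\<^sup>1\<close> says that, as far as containment in \<open>I\<close> is
  concerned, the amount of a product is the product of the amounts; this is
  \<open>finprod_amounts_subset_radical_iff\<close>. Thus a product of elements of \<open>B\<close> in \<open>I\<^sup>\<epsilon>\<close> becomes a product
  of ideals of \<open>R\<close> contained in \<open>I\<close>, strong \<open>n\<close>-absorption deletes one of those ideals, and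
  the translation back deletes the corresponding element. Strong absorption is what the argument
  requires because amounts need not be principal.
\<close>

section \<open>Ideal products inside a radical ideal\<close>

context cring
begin

lemma carrier_ideals_set: "carrier (ideals_set R) = {J. ideal J R}"
  and mult_ideals_set: "J \<otimes>\<^bsub>ideals_set R\<^esub> K = J \<cdot> K"
  and one_ideals_set: "\<one>\<^bsub>ideals_set R\<^esub> = carrier R"
  by (simp_all add: ideals_set_def)

lemma ideal_pow_is_ideal:
  assumes "ideal J R"
  shows "ideal (J [^]\<^bsub>ideals_set R\<^esub> (k::nat)) R"
proof -
  interpret S: comm_monoid "ideals_set R" by (rule ideals_set_is_comm_monoid)
  show ?thesis
    using S.nat_pow_closed[of J k] assms by (simp add: carrier_ideals_set)
qed

lemma ideal_finprod_is_ideal: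
  assumes "J \<in> S \<rightarrow> {K. ideal K R}"
  shows "ideal (\<Otimes>\<^bsub>ideals_set R\<^esub> i \<in> S. J i) R"
proof -
  interpret S: comm_monoid "ideals_set R" by (rule ideals_set_is_comm_monoid)
  show ?thesis
    using S.finprod_closed[of J S] assms by (simp add: carrier_ideals_set)
qed

lemma ideal_prod_mono:
  assumes "J \<subseteq> J'" and "K \<subseteq> K'"
  shows "J \<cdot> K \<subseteq> J' \<cdot> K'"
proof
  fix x assume "x \<in> J \<cdot> K"
  then show "x \<in> J' \<cdot> K'"
    using assms by induct (auto intro: ideal_prod.intros)
qed

lemma ideal_pow_mono:
  assumes "J \<subseteq> K"
  shows "J [^]\<^bsub>ideals_set R\<^esub> (k::nat) \<subseteq> K [^]\<^bsub>ideals_set R\<^esub> k"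
  by (induct k) (simp_all add: mult_ideals_set one_ideals_set nat_pow_def ideal_prod_mono assms)

lemma pow_mem_ideal_pow:
  assumes "x \<in> J"
  shows "x [^] (k::nat) \<in> J [^]\<^bsub>ideals_set R\<^esub> k"
  by (induct k)
    (simp_all add: mult_ideals_set one_ideals_set nat_pow_def ideal_prod.prod assms)

lemma radical_ideal_power_subsetD:
  assumes I: "radical_ideal I R" and J: "ideal J R"
    and sub: "J [^]\<^bsub>ideals_set R\<^esub> Suc k \<subseteq> I"
  shows "J \<subseteq> I"
proof
  fix x assume x: "x \<in> J"
  then have "x [^] Suc k \<in> I"
    using sub pow_mem_ideal_pow by blast
  moreover have "x \<in> carrier R"
    using J x by (rule ideal.Icarr)
  ultimately have "x \<in> ideal_sqrt R I"
    unfolding ideal_sqrt_def by blast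
  then show "x \<in> I"
    using I unfolding radical_ideal_def by blast
qed

text \<open>
  The product \<open>X Y Z\<close> lies in each of its factors, so its power with exponent \<open>m + n + 1\<close> is
  contained in \<open>X\<^sup>m Y\<^sup>n Z\<close>. This is how a radical ideal forgets exponents.
\<close>

lemma radical_ideal_cancel_powers:
  assumes I: "radical_ideal I R"
    and X: "ideal X R" and Y: "ideal Y R" and Z: "ideal Z R"
    and sub: "(X [^]\<^bsub>ideals_set R\<^esub> (m::nat)) \<cdot> (Y [^]\<^bsub>ideals_set R\<^esub> (n::nat)) \<cdot> Z \<subseteq> I"
  shows "X \<cdot> Y \<cdot> Z \<subseteq> I"
proof -
  interpret S: comm_monoid "ideals_set R" by (rule ideals_set_is_comm_monoid)
  let ?P = "X \<cdot> Y \<cdot> Z"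
  have XY: "ideal (X \<cdot> Y) R" and P: "ideal ?P R"
    by (simp_all add: X Y Z ideal_prod_is_ideal)
  have "?P \<subseteq> X" "?P \<subseteq> Y" "?P \<subseteq> Z"
    using ideal_prod_inter[OF XY Z] ideal_prod_inter[OF X Y] by auto
  then have "(?P [^]\<^bsub>ideals_set R\<^esub> m) \<cdot> (?P [^]\<^bsub>ideals_set R\<^esub> n) \<cdot> ?P
      \<subseteq> (X [^]\<^bsub>ideals_set R\<^esub> m) \<cdot> (Y [^]\<^bsub>ideals_set R\<^esub> n) \<cdot> Z"
    by (intro ideal_prod_mono ideal_pow_mono)
  also have "\<dots> \<subseteq> I" by (rule sub)
  also have "(?P [^]\<^bsub>ideals_set R\<^esub> m) \<cdot> (?P [^]\<^bsub>ideals_set R\<^esub> n) \<cdot> ?P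
      = ?P [^]\<^bsub>ideals_set R\<^esub> Suc (m + n)"
    using S.nat_pow_mult[of ?P m n] P by (simp add: carrier_ideals_set mult_ideals_set)
  finally show ?thesis
    by (rule radical_ideal_power_subsetD[OF I P])
qed

end

section \<open>Amounts of products modulo a radical ideal\<close>

context amount_function
begin

lemma amount_finprod_subset:
  assumes "finite S" and "f \<in> S \<rightarrow> carrier B"
  shows "A (\<Otimes>\<^bsub>B\<^esub> i \<in> S. f i) \<subseteq> (\<Otimes>\<^bsub>ideals_set R\<^esub> i \<in> S. A (f i))"
proof -
  interpret S: comm_monoid "ideals_set R" by (rule R.ideals_set_is_comm_monoid)
  show ?thesis
    using assms
  proof (induct S)
    case empty
    show ?case by (simp add: amount_one R.one_ideals_set)
  next
    case (insert x S)
    have fx: "f x \<in> carrier B" and fS: "f \<in> S \<rightarrow> carrier B"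
      using insert.prems by auto
    have "A (f x \<otimes>\<^bsub>B\<^esub> (\<Otimes>\<^bsub>B\<^esub> i \<in> S. f i)) \<subseteq> A (f x) \<cdot>\<^bsub>R\<^esub> A (\<Otimes>\<^bsub>B\<^esub> i \<in> S. f i)"
      by (rule amount_mult[OF fx finprod_closed[OF fS]])
    also have "\<dots> \<subseteq> A (f x) \<cdot>\<^bsub>R\<^esub> (\<Otimes>\<^bsub>ideals_set R\<^esub> i \<in> S. A (f i))"
      by (rule R.ideal_prod_mono[OF subset_refl insert.hyps(3)[OF fS]])
    also have "\<dots> = (\<Otimes>\<^bsub>ideals_set R\<^esub> i \<in> insert x S. A (f i))"
      using insert.hyps(1,2) fx fS
      by (subst S.finprod_insert)
        (auto simp: R.carrier_ideals_set R.mult_ideals_set intro: amount_ideal)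
    finally show ?case
      using insert.hyps(1,2) fx fS by simp
  qed
qed

end

context amount_algebra
begin

text \<open>
  The spare factor \<open>K\<close> lets this two-element step be iterated: in a longer product it holds the
  amounts that have already been split off.
\<close>

lemma split_amount_in_radical:
  assumes I: "radical_ideal I R" and f: "f \<in> carrier B" and g: "g \<in> carrier B"
    and K: "ideal K R" and sub: "A (f \<otimes>\<^bsub>B\<^esub> g) \<cdot>\<^bsub>R\<^esub> K \<subseteq> I"
  shows "A f \<cdot>\<^bsub>R\<^esub> A g \<cdot>\<^bsub>R\<^esub> K \<subseteq> I"
proof -
  have Af: "ideal (A f) R" and Ag: "ideal (A g) R" and Afg: "ideal (A (f \<otimes>\<^bsub>B\<^esub> g)) R"
    using f g by (auto intro: amount_ideal)
  obtain m n :: nat where formula: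
    "(A f [^]\<^bsub>ideals_set R\<^esub> m) \<cdot>\<^bsub>R\<^esub> (A g [^]\<^bsub>ideals_set R\<^esub> n) \<cdot>\<^bsub>R\<^esub> A (f \<otimes>\<^bsub>B\<^esub> g) =
     (A f [^]\<^bsub>ideals_set R\<^esub> (m + 1)) \<cdot>\<^bsub>R\<^esub> (A g [^]\<^bsub>ideals_set R\<^esub> (n + 1))"
    using amount_formula[OF f g] by blast
  let ?Q = "(A f [^]\<^bsub>ideals_set R\<^esub> m) \<cdot>\<^bsub>R\<^esub> (A g [^]\<^bsub>ideals_set R\<^esub> n)"
  have Q: "ideal ?Q R"
    by (intro R.ideal_prod_is_ideal R.ideal_pow_is_ideal Af Ag)
  have "?Q \<cdot>\<^bsub>R\<^esub> A (f \<otimes>\<^bsub>B\<^esub> g) \<cdot>\<^bsub>R\<^esub> K = ?Q \<cdot>\<^bsub>R\<^esub> (A (f \<otimes>\<^bsub>B\<^esub> g) \<cdot>\<^bsub>R\<^esub> K)"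
    by (rule R.ideal_prod_assoc[OF Q Afg K])
  also have "\<dots> \<subseteq> A (f \<otimes>\<^bsub>B\<^esub> g) \<cdot>\<^bsub>R\<^esub> K"
    using R.ideal_prod_inter[OF Q R.ideal_prod_is_ideal[OF Afg K]] by blast
  also have "\<dots> \<subseteq> I" by (rule sub)
  finally show ?thesis
    unfolding formula by (rule R.radical_ideal_cancel_powers[OF I Af Ag K])
qed

lemma finprod_amounts_prod_subset_radical:
  assumes I: "radical_ideal I R" and "finite S" and "f \<in> S \<rightarrow> carrier B"
    and "ideal K R" and "A (\<Otimes>\<^bsub>B\<^esub> i \<in> S. f i) \<cdot>\<^bsub>R\<^esub> K \<subseteq> I"
  shows "(\<Otimes>\<^bsub>ideals_set R\<^esub> i \<in> S. A (f i)) \<cdot>\<^bsub>R\<^esub> K \<subseteq> I"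
proof -
  interpret S: comm_monoid "ideals_set R" by (rule R.ideals_set_is_comm_monoid)
  show ?thesis
    using assms(2-)
  proof (induct S arbitrary: K)
    case empty
    then show ?case by (simp add: amount_one R.one_ideals_set)
  next
    case (insert x S)
    have fx: "f x \<in> carrier B" and fS: "f \<in> S \<rightarrow> carrier B"
      using insert.prems by auto
    let ?g = "\<Otimes>\<^bsub>B\<^esub> i \<in> S. f i" and ?J = "\<Otimes>\<^bsub>ideals_set R\<^esub> i \<in> S. A (f i)"
    have g: "?g \<in> carrier B"
      using fS by (rule finprod_closed)
    have AfS: "(\<lambda>i. A (f i)) \<in> S \<rightarrow> {K. ideal K R}"
      using fS by (auto intro: amount_ideal)
    have K: "ideal K R" and Ax: "ideal (A (f x)) R" and Ag: "ideal (A ?g) R" and J: "ideal ?J R"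
      using insert.prems(2) fx g R.ideal_finprod_is_ideal[OF AfS] by (auto intro: amount_ideal)
    have "A (f x \<otimes>\<^bsub>B\<^esub> ?g) \<cdot>\<^bsub>R\<^esub> K \<subseteq> I"
      using insert.prems(3) insert.hyps(1,2) fx fS by simp
    then have "A (f x) \<cdot>\<^bsub>R\<^esub> A ?g \<cdot>\<^bsub>R\<^esub> K \<subseteq> I"
      by (rule split_amount_in_radical[OF I fx g K])
    then have "A ?g \<cdot>\<^bsub>R\<^esub> (A (f x) \<cdot>\<^bsub>R\<^esub> K) \<subseteq> I"
      using Ax Ag K by (simp add: R.ideal_prod_assoc R.ideal_prod_commute[OF Ax Ag])
    then have "?J \<cdot>\<^bsub>R\<^esub> (A (f x) \<cdot>\<^bsub>R\<^esub> K) \<subseteq> I"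
      using insert.hyps(3)[OF fS R.ideal_prod_is_ideal[OF Ax K]] by blast
    then have "A (f x) \<cdot>\<^bsub>R\<^esub> ?J \<cdot>\<^bsub>R\<^esub> K \<subseteq> I"
      using Ax J K by (simp add: R.ideal_prod_assoc R.ideal_prod_commute[OF Ax J])
    moreover have "(\<Otimes>\<^bsub>ideals_set R\<^esub> i \<in> insert x S. A (f i)) = A (f x) \<cdot>\<^bsub>R\<^esub> ?J"
      using insert.hyps(1,2) Ax AfS
      by (subst S.finprod_insert) (auto simp: R.carrier_ideals_set R.mult_ideals_set)
    ultimately show ?case by simp
  qed
qed

text \<open>
  Submultiplicativity of the amount function gives one direction for any ideal; the other is the
  amount formula with its exponents cancelled.
\<close>

lemma finprod_amounts_subset_radical_iff:
  assumes I: "radical_ideal I R" and S: "finite S" and f: "f \<in> S \<rightarrow> carrier B"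
  shows "(\<Otimes>\<^bsub>ideals_set R\<^esub> i \<in> S. A (f i)) \<subseteq> I \<longleftrightarrow> (\<Otimes>\<^bsub>B\<^esub> i \<in> S. f i) \<in> \<epsilon> I"
proof -
  let ?g = "\<Otimes>\<^bsub>B\<^esub> i \<in> S. f i" and ?J = "\<Otimes>\<^bsub>ideals_set R\<^esub> i \<in> S. A (f i)"
  have g: "?g \<in> carrier B"
    using f by (rule finprod_closed)
  have J: "ideal ?J R"
    by (rule R.ideal_finprod_is_ideal) (use f in \<open>auto intro: amount_ideal\<close>)
  have "?J \<subseteq> I \<longleftrightarrow> A ?g \<subseteq> I"
    using amount_finprod_subset[OF S f]
      finprod_amounts_prod_subset_radical[OF I S f R.oneideal]
    by (auto simp: R.ideal_prod_one J amount_ideal[OF g])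
  then show ?thesis
    using amount_subset_iff[of I ?g] I g by (simp add: radical_ideal_def)
qed

end


section \<open>Extension and contraction of absorbing ideals\<close>

context amount_algebra
begin

lemma eps_eq_carrier_iff:
  assumes "ideal I R"
  shows "\<epsilon> I = carrier B \<longleftrightarrow> I = carrier R"
proof -
  have "\<epsilon> I = carrier B \<longleftrightarrow> \<one>\<^bsub>B\<^esub> \<in> \<epsilon> I"
    using eps_ideal[OF assms] by (metis one_closed ideal.one_imp_carrier)
  also have "\<dots> \<longleftrightarrow> carrier R \<subseteq> I"
    using amount_subset_iff[OF assms one_closed] by (simp add: amount_one)
  also have "\<dots> \<longleftrightarrow> I = carrier R"
    using assms by (auto dest: ideal.Icarr)
  finally show ?thesis .
qed

lemma eps_absorbing:
  assumes I: "radical_ideal I R" and strong: "strongly_absorbing_ideal n I R"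
  shows "absorbing_ideal n (\<epsilon> I) B"
  unfolding absorbing_ideal_def
proof (intro conjI ballI impI)
  have ideal: "ideal I R"
    using I by (simp add: radical_ideal_def)
  show "0 < n"
    using strong by (simp add: strongly_absorbing_ideal_def)
  show "ideal (\<epsilon> I) B"
    using ideal by (rule eps_ideal)
  show "\<epsilon> I \<noteq> carrier B"
    using strong eps_eq_carrier_iff[OF ideal] by (simp add: strongly_absorbing_ideal_def)
next
  fix f assume f: "f \<in> {..n} \<rightarrow> carrier B" and "(\<Otimes>\<^bsub>B\<^esub> i \<in> {..n}. f i) \<in> \<epsilon> I"
  then have "(\<Otimes>\<^bsub>ideals_set R\<^esub> i \<in> {..n}. A (f i)) \<subseteq> I"
    using finprod_amounts_subset_radical_iff[OF I _ f] by simp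
  moreover have "(\<lambda>i. A (f i)) \<in> {..n} \<rightarrow> {K. ideal K R}"
    using f by (auto intro: amount_ideal)
  ultimately obtain j where j: "j \<in> {..n}"
    and "(\<Otimes>\<^bsub>ideals_set R\<^esub> i \<in> {..n} - {j}. A (f i)) \<subseteq> I"
    using strong unfolding strongly_absorbing_ideal_def by blast
  moreover have "f \<in> {..n} - {j} \<rightarrow> carrier B"
    using f by auto
  ultimately have "(\<Otimes>\<^bsub>B\<^esub> i \<in> {..n} - {j}. f i) \<in> \<epsilon> I"
    using finprod_amounts_subset_radical_iff[OF I, of "{..n} - {j}" f] by blast
  with j show "\<exists>j \<in> {..n}. (\<Otimes>\<^bsub>B\<^esub> i \<in> {..n} - {j}. f i) \<in> \<epsilon> I" by blast
qed

end

lemma (in algebra) finprod_structure_map: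
  assumes "finite S" and "r \<in> S \<rightarrow> carrier R"
  shows "(\<Otimes>\<^bsub>M\<^esub> i \<in> S. r i \<odot>\<^bsub>M\<^esub> \<one>\<^bsub>M\<^esub>) = (\<Otimes>\<^bsub>R\<^esub> i \<in> S. r i) \<odot>\<^bsub>M\<^esub> \<one>\<^bsub>M\<^esub>"
  using assms
proof (induct S)
  case empty
  show ?case by simp
next
  case (insert x S)
  let ?p = "\<Otimes>\<^bsub>R\<^esub> i \<in> S. r i"
  have rx: "r x \<in> carrier R" and rS: "r \<in> S \<rightarrow> carrier R" and p: "?p \<in> carrier R"
    using insert.prems by (auto intro!: R.finprod_closed)
  have "(\<Otimes>\<^bsub>M\<^esub> i \<in> insert x S. r i \<odot>\<^bsub>M\<^esub> \<one>\<^bsub>M\<^esub>)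
      = (r x \<odot>\<^bsub>M\<^esub> \<one>\<^bsub>M\<^esub>) \<otimes>\<^bsub>M\<^esub> (?p \<odot>\<^bsub>M\<^esub> \<one>\<^bsub>M\<^esub>)"
    using insert.hyps rx rS by (subst finprod_insert) auto
  also have "\<dots> = (r x \<otimes>\<^bsub>R\<^esub> ?p) \<odot>\<^bsub>M\<^esub> \<one>\<^bsub>M\<^esub>"
    using rx p by (simp add: smult_assoc2 smult_assoc1)
  finally show ?case
    using insert.hyps rx rS by simp
qed

lemma (in algebra) absorbing_ideal_contract:
  assumes abs: "absorbing_ideal n J M" and I: "ideal I R"
    and contract: "{r \<in> carrier R. r \<odot>\<^bsub>M\<^esub> \<one>\<^bsub>M\<^esub> \<in> J} = I"
  shows "absorbing_ideal n I R"
  unfolding absorbing_ideal_def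
proof (intro conjI ballI impI)
  show "0 < n"
    using abs by (simp add: absorbing_ideal_def)
  show "ideal I R" by (rule I)
  have J: "ideal J M" "J \<noteq> carrier M"
    using abs by (simp_all add: absorbing_ideal_def)
  show "I \<noteq> carrier R"
  proof
    assume "I = carrier R"
    then have "\<one>\<^bsub>R\<^esub> \<odot>\<^bsub>M\<^esub> \<one>\<^bsub>M\<^esub> \<in> J"
      using contract by blast
    then show False
      using J ideal.one_imp_carrier[OF J(1)] by simp
  qed
next
  have mem: "(\<Otimes>\<^bsub>M\<^esub> i \<in> S. r i \<odot>\<^bsub>M\<^esub> \<one>\<^bsub>M\<^esub>) \<in> J \<longleftrightarrow> (\<Otimes>\<^bsub>R\<^esub> i \<in> S. r i) \<in> I"
    if "finite S" "r \<in> S \<rightarrow> carrier R" for r and S :: "nat set"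
    using that R.finprod_closed[of r S] contract by (auto simp: finprod_structure_map)
  fix r assume r: "r \<in> {..n} \<rightarrow> carrier R" and "(\<Otimes>\<^bsub>R\<^esub> i \<in> {..n}. r i) \<in> I"
  then have "(\<Otimes>\<^bsub>M\<^esub> i \<in> {..n}. r i \<odot>\<^bsub>M\<^esub> \<one>\<^bsub>M\<^esub>) \<in> J"
    using mem by simp
  moreover have "(\<lambda>i. r i \<odot>\<^bsub>M\<^esub> \<one>\<^bsub>M\<^esub>) \<in> {..n} \<rightarrow> carrier M"
    using r by auto
  ultimately obtain j where j: "j \<in> {..n}"
    and "(\<Otimes>\<^bsub>M\<^esub> i \<in> {..n} - {j}. r i \<odot>\<^bsub>M\<^esub> \<one>\<^bsub>M\<^esub>) \<in> J"
    using abs unfolding absorbing_ideal_def by blast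
  moreover have "r \<in> {..n} - {j} \<rightarrow> carrier R"
    using r by auto
  ultimately have "(\<Otimes>\<^bsub>R\<^esub> i \<in> {..n} - {j}. r i) \<in> I"
    using mem by simp
  with j show "\<exists>j \<in> {..n}. (\<Otimes>\<^bsub>R\<^esub> i \<in> {..n} - {j}. r i) \<in> I" by blast
qed


section \<open>Equality of the absorbing numbers\<close>

theorem theorem24:
  fixes R :: "('a, 'm) ring_scheme"
    and B :: "('a, 'b, 'c) module_scheme"
    and A :: "'b \<Rightarrow> 'a set"
    and \<epsilon> :: "'a set \<Rightarrow> 'b set"
    and I :: "'a set"
  assumes "cring R"
    and "\<And>n J. absorbing_ideal n J R \<Longrightarrow> strongly_absorbing_ideal n J R"
    and "amount_algebra R B A \<epsilon>"
    and "radical_ideal I R"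
  shows "absorbing_number B (\<epsilon> I) = absorbing_number R I"
proof -
  interpret amount_algebra R B A \<epsilon> by fact
  have I: "ideal I R"
    using assms(4) by (simp add: radical_ideal_def)
  have "absorbing_ideal n (\<epsilon> I) B \<longleftrightarrow> absorbing_ideal n I R" for n
    using eps_absorbing[OF assms(4) assms(2)]
      absorbing_ideal_contract[OF _ I eps_contract[OF I]] by blast
  then show ?thesis
    by (simp add: absorbing_number_def)
qed

end
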